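(* Let $n\ge1$ and let $\alpha\in\mathcal{ODCT}_n$ be the constant map with value $1$. Then $\alpha\le\beta$ for all $\beta\in\mathcal{ODCT}_n$.
   Context: $[n]=\{1,2,\ldots,n\}$ with its usual order. Maps are written on the right of their arguments. $\mathcal{ODCT}_n$ is the semigroup (under composition, $x(\alpha\beta)=(x\alpha)\beta$) of all maps $\alpha:[n]\to[n]$ that are contractions ($|x\alpha-y\alpha|\le|x-y|$ for all $x,y\in[n]$), order-preserving ($x\le y\Rightarrow x\alpha\le y\alpha$) and order-decreasing ($x\alpha\le x$ for all $x\in[n]$). The natural partial order on a semigroup $S$: $\alpha\le\beta$ iff there exist $\lambda,\mu\in S^1$ with $\alpha=\lambda\beta=\beta\mu$ and $\alpha=\alpha\mu$; here $S=\mathcal{ODCT}_n$. *)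

theory Defs
  imports Main "HOL-Library.FuncSet"
begin

text \<open>
  A semigroup is given by a carrier \<open>S\<close> and an operation \<open>m\<close>.  The monoid \<open>S\<^sup>1\<close> is \<open>S\<close> itself
  if \<open>S\<close> already has an identity, and \<open>S\<close> with a new identity adjoined otherwise; elements of
  \<open>S\<close> are embedded by \<open>Some\<close> and \<open>None\<close> is the new identity.
\<close>

definition has_identity :: "'a set \<Rightarrow> ('a \<Rightarrow> 'a \<Rightarrow> 'a) \<Rightarrow> bool" where
  "has_identity S m \<longleftrightarrow> (\<exists>e\<in>S. \<forall>x\<in>S. m e x = x \<and> m x e = x)"

definition adjoin_one :: "'a set \<Rightarrow> ('a \<Rightarrow> 'a \<Rightarrow> 'a) \<Rightarrow> 'a option set" where
  "adjoin_one S m = (if has_identity S m then Some ` S else insert None (Some ` S))"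

fun mult_one :: "('a \<Rightarrow> 'a \<Rightarrow> 'a) \<Rightarrow> 'a option \<Rightarrow> 'a option \<Rightarrow> 'a option" where
  "mult_one m None y = y"
| "mult_one m (Some x) None = Some x"
| "mult_one m (Some x) (Some y) = Some (m x y)"

definition natural_le :: "'a set \<Rightarrow> ('a \<Rightarrow> 'a \<Rightarrow> 'a) \<Rightarrow> 'a \<Rightarrow> 'a \<Rightarrow> bool" where
  "natural_le S m a b \<longleftrightarrow>
     (\<exists>l\<in>adjoin_one S m. \<exists>u\<in>adjoin_one S m.
        Some a = mult_one m l (Some b) \<and>
        Some a = mult_one m (Some b) u \<and>
        Some a = mult_one m (Some a) u)"

text \<open>
  Maps on \<open>{1..n}\<close> are extensional functions (value \<open>undefined\<close> outside \<open>{1..n}\<close>), so that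
  equality of maps is equality of functions.  Distances are taken in \<open>int\<close> because subtraction
  on \<open>nat\<close> truncates.
\<close>

definition ODCT :: "nat \<Rightarrow> (nat \<Rightarrow> nat) set" where
  "ODCT n = {f \<in> {1..n} \<rightarrow>\<^sub>E {1..n}.
     (\<forall>x\<in>{1..n}. \<forall>y\<in>{1..n}. \<bar>int (f x) - int (f y)\<bar> \<le> \<bar>int x - int y\<bar>) \<and>
     (\<forall>x\<in>{1..n}. \<forall>y\<in>{1..n}. x \<le> y \<longrightarrow> f x \<le> f y) \<and>
     (\<forall>x\<in>{1..n}. f x \<le> x)}"

text \<open>Maps act on the right, so the product \<open>f g\<close> applies \<open>f\<close> first.\<close>

definition rcomp :: "nat \<Rightarrow> (nat \<Rightarrow> nat) \<Rightarrow> (nat \<Rightarrow> nat) \<Rightarrow> (nat \<Rightarrow> nat)" where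
  "rcomp n f g = compose {1..n} g f"

lemma rcomp_closed:
  assumes f: "f \<in> ODCT n" and g: "g \<in> ODCT n"
  shows "rcomp n f g \<in> ODCT n"
proof -
  have fm: "f x \<in> {1..n}" if "x \<in> {1..n}" for x
    using f that unfolding ODCT_def by blast
  have gm: "g x \<in> {1..n}" if "x \<in> {1..n}" for x
    using g that unfolding ODCT_def by blast
  have v: "rcomp n f g x = g (f x)" if "x \<in> {1..n}" for x
    using that by (simp add: rcomp_def compose_def)
  have "rcomp n f g \<in> {1..n} \<rightarrow>\<^sub>E {1..n}"
  proof (rule PiE_I)
    show "rcomp n f g x \<in> {1..n}" if "x \<in> {1..n}" for x
      using v[OF that] gm[OF fm[OF that]] by simp
    show "rcomp n f g x = undefined" if "x \<notin> {1..n}" for x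
      using that unfolding rcomp_def compose_def restrict_def by (simp only: if_False)
  qed
  moreover have "\<bar>int (rcomp n f g x) - int (rcomp n f g y)\<bar> \<le> \<bar>int x - int y\<bar>"
    if "x \<in> {1..n}" "y \<in> {1..n}" for x y
  proof -
    have "\<bar>int (g (f x)) - int (g (f y))\<bar> \<le> \<bar>int (f x) - int (f y)\<bar>"
      using g fm that unfolding ODCT_def by blast
    also have "\<dots> \<le> \<bar>int x - int y\<bar>"
      using f that unfolding ODCT_def by blast
    finally show ?thesis using v that by simp
  qed
  moreover have "rcomp n f g x \<le> rcomp n f g y"
    if "x \<in> {1..n}" "y \<in> {1..n}" "x \<le> y" for x y
  proof -
    have "f x \<le> f y" using f that unfolding ODCT_def by blast
    then have "g (f x) \<le> g (f y)" using g fm that unfolding ODCT_def by blast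
    then show ?thesis using v that by simp
  qed
  moreover have "rcomp n f g x \<le> x" if "x \<in> {1..n}" for x
  proof -
    have "g (f x) \<le> f x" using g fm that unfolding ODCT_def by blast
    also have "f x \<le> x" using f that unfolding ODCT_def by blast
    finally show ?thesis using v that by simp
  qed
  ultimately show ?thesis unfolding ODCT_def by blast
qed

end

theory Submission
  imports Defs
begin

text \<open>
  The constant map \<open>\<alpha>\<close> with value \<open>1\<close> is a zero of the semigroup.  Applying \<open>\<alpha>\<close> after
  any map sends everything to \<open>1\<close>, and applying a map \<open>\<beta>\<close> after \<open>\<alpha>\<close> changes nothing,
  because an order-decreasing \<open>\<beta>\<close> has to fix the least point \<open>1\<close>.  A zero lies below every
  element in the natural partial order of any semigroup, with the zero itself as both multipliers.
\<close>

lemma zero_natural_le: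
  assumes "z \<in> S" and "m z b = z" and "m b z = z" and "m z z = z"
  shows "natural_le S m z b"
proof -
  have "Some z \<in> adjoin_one S m"
    using assms(1) by (simp add: adjoin_one_def)
  then show ?thesis
    unfolding natural_le_def using assms(2-4)
    by (intro bexI[of _ "Some z"]) simp_all
qed

lemma ODCT_fixes_one:
  assumes "\<beta> \<in> ODCT n" and "n \<ge> 1"
  shows "\<beta> 1 = 1"
proof -
  have "1 \<in> {1..n}"
    using assms(2) by simp
  then have "\<beta> 1 \<in> {1..n}" and "\<beta> 1 \<le> 1"
    using assms(1) unfolding ODCT_def by blast+
  then show ?thesis by simp
qed

lemma ODCT_eqI:
  assumes "f \<in> ODCT n" and "g \<in> ODCT n" and "\<And>x. x \<in> {1..n} \<Longrightarrow> f x = g x"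
  shows "f = g"
proof (rule PiE_ext)
  show "f \<in> {1..n} \<rightarrow>\<^sub>E {1..n}" and "g \<in> {1..n} \<rightarrow>\<^sub>E {1..n}"
    using assms(1,2) by (simp_all add: ODCT_def)
qed (rule assms(3))

lemma const_one_absorbs:
  assumes "n \<ge> 1" and "\<alpha> \<in> ODCT n" and "\<forall>x\<in>{1..n}. \<alpha> x = 1" and "\<beta> \<in> ODCT n"
  shows "rcomp n \<alpha> \<beta> = \<alpha>" and "rcomp n \<beta> \<alpha> = \<alpha>"
proof -
  show "rcomp n \<alpha> \<beta> = \<alpha>"
  proof (rule ODCT_eqI[OF rcomp_closed[OF assms(2,4)] assms(2)])
    fix x assume "x \<in> {1..n}"
    then show "rcomp n \<alpha> \<beta> x = \<alpha> x"
      using assms(3) ODCT_fixes_one[OF assms(4,1)] by (simp add: rcomp_def compose_def)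
  qed
  show "rcomp n \<beta> \<alpha> = \<alpha>"
  proof (rule ODCT_eqI[OF rcomp_closed[OF assms(4,2)] assms(2)])
    fix x assume x: "x \<in> {1..n}"
    then have "\<beta> x \<in> {1..n}"
      using assms(4) unfolding ODCT_def by blast
    then show "rcomp n \<beta> \<alpha> x = \<alpha> x"
      using assms(3) x by (simp add: rcomp_def compose_def)
  qed
qed

theorem corollary28:
  fixes n :: nat and \<alpha> :: "nat \<Rightarrow> nat"
  assumes "n \<ge> 1"
    and "\<alpha> \<in> ODCT n"
    and "\<forall>x\<in>{1..n}. \<alpha> x = 1"
  shows "\<forall>\<beta>\<in>ODCT n. natural_le (ODCT n) (rcomp n) \<alpha> \<beta>"
proof
  fix \<beta> assume "\<beta> \<in> ODCT n"
  then show "natural_le (ODCT n) (rcomp n) \<alpha> \<beta>"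
    using zero_natural_le[OF assms(2)] const_one_absorbs[OF assms] assms(2) by simp
qed

end
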